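(* If $G$ is a graph with $n = |V(G)|$, then $$\chi_D(G)\,\chi_D(\overline{G}) \le \left(\frac{n+D(G)}{2}\right)^2.$$
   Context: Graphs are finite and simple; $\overline{G}$ denotes the complement of $G$. A labeling (coloring) $h: V(G)\to\{1,\dots,r\}$ is distinguishing if the only automorphism of $G$ that preserves all vertex labels is the identity. The distinguishing number $D(G)$ is the minimum $r$ such that $G$ has a distinguishing labeling with labels in $\{1,\dots,r\}$. The distinguishing chromatic number $\chi_D(G)$ is the minimum $r$ such that $G$ has a labeling with labels in $\{1,\dots,r\}$ that is both a proper coloring and distinguishing. *)

theory Defs
  imports Complex_Main "Graph_Theory.Pair_Digraph"
begin

text \<open>
  Finite simple graphs are the \<^locale>\<open>pair_graph\<close>s of the AFP entry Graph_Theory: finite, loop-free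
  and symmetric, an undirected edge \<open>uv\<close> being the two arcs \<open>(u, v)\<close> and \<open>(v, u)\<close>.
\<close>

definition graph_complement :: "'a pair_pre_digraph \<Rightarrow> 'a pair_pre_digraph" where
  "graph_complement G =
     \<lparr> pverts = pverts G,
       parcs = {(u, v). u \<in> pverts G \<and> v \<in> pverts G \<and> u \<noteq> v \<and> (u, v) \<notin> parcs G} \<rparr>"

text \<open>
  An automorphism is a function on the whole vertex type, of which only the restriction to the
  vertex set matters; in particular being the identity means being the identity on the vertices.
\<close>

definition graph_automorphism :: "'a pair_pre_digraph \<Rightarrow> ('a \<Rightarrow> 'a) \<Rightarrow> bool" where
  "graph_automorphism G f \<longleftrightarrow>
     bij_betw f (pverts G) (pverts G) \<and>
     (\<forall>u \<in> pverts G. \<forall>v \<in> pverts G. (f u, f v) \<in> parcs G \<longleftrightarrow> (u, v) \<in> parcs G)"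

definition labeling :: "'a pair_pre_digraph \<Rightarrow> nat \<Rightarrow> ('a \<Rightarrow> nat) \<Rightarrow> bool" where
  "labeling G r h \<longleftrightarrow> h ` pverts G \<subseteq> {1..r}"

definition distinguishing :: "'a pair_pre_digraph \<Rightarrow> ('a \<Rightarrow> nat) \<Rightarrow> bool" where
  "distinguishing G h \<longleftrightarrow>
     (\<forall>f. graph_automorphism G f \<and> (\<forall>v \<in> pverts G. h (f v) = h v)
          \<longrightarrow> (\<forall>v \<in> pverts G. f v = v))"

definition proper_coloring :: "'a pair_pre_digraph \<Rightarrow> ('a \<Rightarrow> nat) \<Rightarrow> bool" where
  "proper_coloring G h \<longleftrightarrow> (\<forall>(u, v) \<in> parcs G. h u \<noteq> h v)"

definition distinguishing_number :: "'a pair_pre_digraph \<Rightarrow> nat" where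
  "distinguishing_number G = (LEAST r. \<exists>h. labeling G r h \<and> distinguishing G h)"

definition distinguishing_chromatic_number :: "'a pair_pre_digraph \<Rightarrow> nat" where
  "distinguishing_chromatic_number G =
     (LEAST r. \<exists>h. labeling G r h \<and> proper_coloring G h \<and> distinguishing G h)"

lemma pair_graph_complement:
  assumes "pair_graph G"
  shows "pair_graph (graph_complement G)"
proof -
  interpret pair_graph G by (rule assms)
  have "finite (parcs (graph_complement G))"
    by (rule finite_subset[of _ "pverts G \<times> pverts G"])
       (auto simp: graph_complement_def pair_finite_verts)
  moreover have "sym (parcs G)"
    using pair_sym_arcs by (simp add: symmetric_def)
  ultimately show ?thesis
    using pair_finite_verts
    by unfold_locales (auto simp: graph_complement_def symmetric_def intro!: symI dest: symD)
qed

text \<open>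
  The minima defining the two numbers are taken over nonempty sets: giving all vertices different
  labels is always possible with as many labels as there are vertices.
\<close>

lemma distinguishing_proper_labeling_exists:
  assumes "pair_graph G"
  shows "\<exists>h. labeling G (card (pverts G)) h \<and> proper_coloring G h \<and> distinguishing G h"
proof -
  interpret pair_graph G by (rule assms)
  obtain h where h: "bij_betw h (pverts G) {1..card (pverts G)}"
    using ex_bij_betw_finite_nat[OF pair_finite_verts] finite_same_card_bij[of "pverts G" "{1..card (pverts G)}"]
      pair_finite_verts by auto
  then have inj: "inj_on h (pverts G)" by (rule bij_betw_imp_inj_on)
  have "labeling G (card (pverts G)) h"
    using h by (auto simp: labeling_def bij_betw_def)
  moreover have "proper_coloring G h"
    using inj by (auto simp: proper_coloring_def dest: inj_onD in_arcsD1 in_arcsD2 no_loops')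
  moreover have "distinguishing G h"
    unfolding distinguishing_def graph_automorphism_def
    using inj by (meson bij_betwE inj_onD)
  ultimately show ?thesis by blast
qed

end

theory Submission
  imports Defs
begin

text \<open>
  By the inequality of arithmetic and geometric means it suffices to bound the sum:
  \<open>\<chi>\<^sub>D(G) + \<chi>\<^sub>D(G') \<le> n + D(G)\<close>, where \<open>G'\<close> is the complement. Take a distinguishing labeling \<open>h\<close> of
  \<open>G\<close> with \<open>D(G)\<close> labels. It is distinguishing for \<open>G'\<close> as well, since a graph and its complement
  have the same automorphisms. Any coloring that is finer than \<open>h\<close> is still distinguishing, so on
  each label class \<open>V\<^sub>i\<close> separately it only remains to color properly, with disjoint palettes for
  different classes. The Nordhaus-Gaddum bound (lemma \<open>nordhaus_gaddum\<close>) does this for \<open>G\<close> and \<open>G'\<close>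
  with at most \<open>card V\<^sub>i + 1\<close> colors in total on \<open>V\<^sub>i\<close>, and these numbers add up to \<open>n + D(G)\<close>
  (lemma \<open>nordhaus_gaddum_refining\<close>).
\<close>

text \<open>
  Pairs on the diagonal are disregarded, so that \<open>- E\<close> can serve as the edge relation of the
  complement and the two graphs are treated symmetrically.
\<close>

definition proper_on :: "'a set \<Rightarrow> ('a \<times> 'a) set \<Rightarrow> ('a \<Rightarrow> 'b) \<Rightarrow> bool" where
  "proper_on S E f \<longleftrightarrow> (\<forall>u \<in> S. \<forall>v \<in> S. u \<noteq> v \<and> (u, v) \<in> E \<longrightarrow> f u \<noteq> f v)"

text \<open>
  A color that the neighbors of a new vertex leave free is reused; a fresh color is needed only
  when they occupy the whole palette.
\<close>

lemma proper_on_extend_reuse: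
  fixes f :: "'a \<Rightarrow> 'b"
  assumes "finite S" "x \<notin> S" "sym E" "proper_on S E f"
    and "card {u \<in> S. (u, x) \<in> E} < card (f ` S)"
  shows "\<exists>f' :: 'a \<Rightarrow> 'b. proper_on (insert x S) E f' \<and> card (f' ` insert x S) = card (f ` S)"
proof -
  let ?N = "{u \<in> S. (u, x) \<in> E}"
  have "card (f ` ?N) < card (f ` S)"
    using card_image_le[of ?N f] assms(1,5) by simp
  then have "\<not> f ` S \<subseteq> f ` ?N"
    using card_mono[OF finite_imageI[of ?N f], of "f ` S"] assms(1) by force
  then obtain c where c: "c \<in> f ` S" "c \<notin> f ` ?N" by blast
  have "proper_on (insert x S) E (f(x := c))"
    using c(2) assms(2-4) by (auto simp: proper_on_def dest: symD)
  moreover have "(f(x := c)) ` insert x S = f ` S"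
    using c(1) assms(2) by auto
  ultimately show ?thesis by (intro exI[of _ "f(x := c)"]) simp
qed

lemma proper_on_extend_fresh:
  fixes f :: "'a \<Rightarrow> nat"
  assumes "finite S" "x \<notin> S" "proper_on S E f"
  shows "\<exists>f' :: 'a \<Rightarrow> nat. proper_on (insert x S) E f' \<and> card (f' ` insert x S) = Suc (card (f ` S))"
proof -
  obtain c where c: "c \<notin> f ` S"
    using assms(1) ex_new_if_finite[OF infinite_UNIV_nat] by blast
  have "proper_on (insert x S) E (f(x := c))"
    using c assms(2,3) by (auto simp: proper_on_def)
  moreover have "(f(x := c)) ` insert x S = insert c (f ` S)"
    using assms(2) by auto
  ultimately show ?thesis
    using c assms(1) by (intro exI[of _ "f(x := c)"]) simp
qed

text \<open>
  Induction on the number of vertices. Each earlier vertex is adjacent to the new vertex \<open>x\<close> in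
  exactly one of the two graphs, so the two degrees of \<open>x\<close> sum to \<open>card S\<close>. If the two palettes
  together have more than \<open>card S\<close> colors, in one of the graphs the degree of \<open>x\<close> is below the size
  of the palette and a color can be reused there; otherwise there is room for two fresh colors.
\<close>

lemma nordhaus_gaddum:
  assumes "finite S" "sym E"
  shows "\<exists>(f :: 'a \<Rightarrow> nat) (g :: 'a \<Rightarrow> nat).
    proper_on S E f \<and> proper_on S (- E) g \<and> card (f ` S) + card (g ` S) \<le> card S + 1"
  using assms(1)
proof induction
  case empty
  show ?case by (auto simp: proper_on_def)
next
  case (insert x S)
  then obtain f g :: "'a \<Rightarrow> nat" where f: "proper_on S E f" and g: "proper_on S (- E) g"
    and le: "card (f ` S) + card (g ` S) \<le> card S + 1" by blast
  let ?d = "card {u \<in> S. (u, x) \<in> E}" and ?d' = "card {u \<in> S. (u, x) \<in> - E}"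
  have "{u \<in> S. (u, x) \<in> E} \<union> {u \<in> S. (u, x) \<in> - E} = S" by blast
  then have deg: "?d + ?d' = card S"
    using card_Un_disjoint[of "{u \<in> S. (u, x) \<in> E}" "{u \<in> S. (u, x) \<in> - E}"] insert.hyps(1)
    by fastforce
  have sym': "sym (- E)" using assms(2) by (auto simp: sym_def)
  obtain f' :: "'a \<Rightarrow> nat" where f': "proper_on (insert x S) E f'"
    and cf: "card (f' ` insert x S) = (if ?d < card (f ` S) then card (f ` S) else Suc (card (f ` S)))"
    using proper_on_extend_reuse[OF insert.hyps assms(2) f] proper_on_extend_fresh[OF insert.hyps f]
    by (cases "?d < card (f ` S)") auto
  obtain g' :: "'a \<Rightarrow> nat" where g': "proper_on (insert x S) (- E) g'"
    and cg: "card (g' ` insert x S) = (if ?d' < card (g ` S) then card (g ` S) else Suc (card (g ` S)))"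
    using proper_on_extend_reuse[OF insert.hyps sym' g] proper_on_extend_fresh[OF insert.hyps g]
    by (cases "?d' < card (g ` S)") auto
  have "card (f' ` insert x S) + card (g' ` insert x S) \<le> card (insert x S) + 1"
    using le deg insert.hyps by (simp only: cf cg) auto
  with f' g' show ?case by blast
qed

text \<open>Pairing a color with the label of its class keeps the palettes of different classes apart.\<close>

lemma proper_on_pair_label:
  assumes "\<And>i. proper_on {v \<in> S. h v = i} E (f i)"
  shows "proper_on S E (\<lambda>v. (h v, f (h v) v))"
  unfolding proper_on_def
proof (intro ballI impI)
  fix u v
  assume "u \<in> S" "v \<in> S" "u \<noteq> v \<and> (u, v) \<in> E"
  then show "(h u, f (h u) u) \<noteq> (h v, f (h v) v)"
    using assms[of "h v"] by (auto simp: proper_on_def)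
qed

lemma card_image_pair_label_le:
  assumes "finite S" "finite I" "h ` S \<subseteq> I"
  shows "card ((\<lambda>v. (h v, f (h v) v)) ` S) \<le> (\<Sum>i\<in>I. card (f i ` {v \<in> S. h v = i}))"
proof -
  have "(\<lambda>v. (h v, f (h v) v)) ` S \<subseteq> (SIGMA i:I. f i ` {v \<in> S. h v = i})"
    using assms(3) by auto
  then show ?thesis
    using card_mono[of "SIGMA i:I. f i ` {v \<in> S. h v = i}"] assms(1,2) by (simp add: card_SigmaI)
qed

lemma nordhaus_gaddum_refining:
  fixes h :: "'a \<Rightarrow> 'b"
  assumes "finite S" "sym E" "finite I" "h ` S \<subseteq> I"
  shows "\<exists>(F :: 'a \<Rightarrow> 'b \<times> nat) (F' :: 'a \<Rightarrow> 'b \<times> nat).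
    proper_on S E F \<and> proper_on S (- E) F' \<and> fst \<circ> F = h \<and> fst \<circ> F' = h \<and>
    card (F ` S) + card (F' ` S) \<le> card S + card I"
proof -
  define C where "C i = {v \<in> S. h v = i}" for i
  have "\<forall>i. \<exists>(f :: 'a \<Rightarrow> nat) (g :: 'a \<Rightarrow> nat). proper_on (C i) E f \<and> proper_on (C i) (- E) g \<and>
      card (f ` C i) + card (g ` C i) \<le> card (C i) + 1"
    using nordhaus_gaddum[OF _ assms(2)] assms(1) by (simp add: C_def)
  then obtain f g :: "'b \<Rightarrow> 'a \<Rightarrow> nat" where
    f: "\<And>i. proper_on (C i) E (f i)" and g: "\<And>i. proper_on (C i) (- E) (g i)"
    and le: "\<And>i. card (f i ` C i) + card (g i ` C i) \<le> card (C i) + 1"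
    by metis
  let ?F = "\<lambda>v. (h v, f (h v) v)" and ?G = "\<lambda>v. (h v, g (h v) v)"
  have "card (?F ` S) + card (?G ` S) \<le> (\<Sum>i\<in>I. card (f i ` C i)) + (\<Sum>i\<in>I. card (g i ` C i))"
    unfolding C_def using assms by (intro add_mono card_image_pair_label_le)
  also have "\<dots> \<le> (\<Sum>i\<in>I. card (C i) + 1)"
    unfolding sum.distrib[symmetric] by (intro sum_mono le)
  also have "\<dots> = (\<Sum>i\<in>I. card (C i)) + card I"
    unfolding sum.distrib by simp
  also have "(\<Sum>i\<in>I. card (C i)) = card S"
    unfolding C_def card_eq_sum by (rule sum.group[OF assms(1,3,4)])
  finally have "card (?F ` S) + card (?G ` S) \<le> card S + card I" .
  moreover have "proper_on S E ?F"
    using f unfolding C_def by (rule proper_on_pair_label)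
  moreover have "proper_on S (- E) ?G"
    using g unfolding C_def by (rule proper_on_pair_label)
  ultimately show ?thesis
    by (intro exI[of _ ?F] exI[of _ ?G]) (simp add: fun_eq_iff)
qed

text \<open>An automorphism that preserves the finer labels also preserves the coarser ones.\<close>

lemma distinguishing_refine:
  assumes "distinguishing G h"
    and "\<And>u v. u \<in> pverts G \<Longrightarrow> v \<in> pverts G \<Longrightarrow> F u = F v \<Longrightarrow> h u = h v"
  shows "distinguishing G F"
  unfolding distinguishing_def
proof (intro allI impI, elim conjE)
  fix f
  assume f: "graph_automorphism G f" "\<forall>v \<in> pverts G. F (f v) = F v"
  then have "f v \<in> pverts G" if "v \<in> pverts G" for v
    using that by (auto simp: graph_automorphism_def dest: bij_betwE)
  then have "\<forall>v \<in> pverts G. h (f v) = h v"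
    using f(2) assms(2) by blast
  with assms(1) f(1) show "\<forall>v \<in> pverts G. f v = v"
    by (simp add: distinguishing_def)
qed

lemma distinguishing_graph_complement:
  assumes "pair_graph G" "distinguishing G h"
  shows "distinguishing (graph_complement G) h"
proof -
  interpret pair_graph G by (rule assms)
  have "graph_automorphism G f" if "graph_automorphism (graph_complement G) f" for f
  proof -
    have bij: "bij_betw f (pverts G) (pverts G)"
      using that by (simp add: graph_automorphism_def graph_complement_def)
    have "(f u, f v) \<in> parcs G \<longleftrightarrow> (u, v) \<in> parcs G" if uv: "u \<in> pverts G" "v \<in> pverts G" for u v
    proof (cases "u = v")
      case True
      then show ?thesis by (auto dest: no_loops')
    next
      case False
      then have "f u \<noteq> f v" "f u \<in> pverts G" "f v \<in> pverts G"
        using bij uv by (auto simp: bij_betw_def inj_on_def)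
      then show ?thesis
        using False uv \<open>graph_automorphism (graph_complement G) f\<close>
        by (auto simp: graph_automorphism_def graph_complement_def)
    qed
    with bij show ?thesis by (simp add: graph_automorphism_def)
  qed
  with assms(2) show ?thesis
    by (simp add: distinguishing_def) (simp add: graph_complement_def)
qed

text \<open>
  The values of a coloring do not matter, only their number: renumbering them as \<open>1, 2, \<dots>\<close> gives
  a labeling that is still proper and finer than \<open>h\<close>.
\<close>

lemma distinguishing_chromatic_number_le_card:
  assumes "pair_graph G" "proper_on (pverts G) (parcs G) F" "distinguishing G h"
    and "\<And>u v. u \<in> pverts G \<Longrightarrow> v \<in> pverts G \<Longrightarrow> F u = F v \<Longrightarrow> h u = h v"
  shows "distinguishing_chromatic_number G \<le> card (F ` pverts G)"
proof -
  interpret pair_graph G by (rule assms)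
  obtain b where b: "bij_betw b (F ` pverts G) {1..card (F ` pverts G)}"
    using finite_same_card_bij[of "F ` pverts G" "{1..card (F ` pverts G)}"] pair_finite_verts
    by auto
  have same: "F u = F v" if "b (F u) = b (F v)" "u \<in> pverts G" "v \<in> pverts G" for u v
    using that bij_betw_imp_inj_on[OF b] by (auto dest: inj_onD)
  have "labeling G (card (F ` pverts G)) (b \<circ> F)"
    using b by (auto simp: labeling_def bij_betw_def)
  moreover have "proper_coloring G (b \<circ> F)"
    unfolding proper_coloring_def
  proof safe
    fix u v
    assume uv: "(u, v) \<in> parcs G" and eq: "(b \<circ> F) u = (b \<circ> F) v"
    have "u \<in> pverts G" "v \<in> pverts G" "u \<noteq> v"
      using uv by (auto dest: in_arcsD1 in_arcsD2 no_loops')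
    with uv eq same[of u v] assms(2) show False by (simp add: proper_on_def)
  qed
  moreover have "distinguishing G (b \<circ> F)"
  proof (rule distinguishing_refine[OF assms(3)])
    fix u v
    assume uv: "u \<in> pverts G" "v \<in> pverts G" and "(b \<circ> F) u = (b \<circ> F) v"
    then have "b (F u) = b (F v)" by simp
    then show "h u = h v" by (intro assms(4)[OF uv] same uv)
  qed
  ultimately show ?thesis
    unfolding distinguishing_chromatic_number_def by (intro Least_le) blast
qed

lemma distinguishing_number_attained:
  assumes "pair_graph G"
  shows "\<exists>h. labeling G (distinguishing_number G) h \<and> distinguishing G h"
proof -
  have "\<exists>r h. labeling G r h \<and> distinguishing G h"
    using distinguishing_proper_labeling_exists[OF assms] by blast
  then show ?thesis
    unfolding distinguishing_number_def by (rule LeastI_ex)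
qed

lemma distinguishing_chromatic_number_sum_le:
  assumes "pair_graph G"
  shows "distinguishing_chromatic_number G + distinguishing_chromatic_number (graph_complement G)
    \<le> card (pverts G) + distinguishing_number G"
proof -
  interpret pair_graph G by (rule assms)
  let ?D = "distinguishing_number G" and ?H = "graph_complement G"
  obtain h where h: "labeling G ?D h" "distinguishing G h"
    using distinguishing_number_attained[OF assms] by blast
  have "sym (parcs G)" using pair_sym_arcs by (simp add: symmetric_def)
  then obtain F F' :: "'a \<Rightarrow> nat \<times> nat" where
    F: "proper_on (pverts G) (parcs G) F" "fst \<circ> F = h" and
    F': "proper_on (pverts G) (- parcs G) F'" "fst \<circ> F' = h" and
    le: "card (F ` pverts G) + card (F' ` pverts G) \<le> card (pverts G) + ?D"
    using nordhaus_gaddum_refining[of "pverts G" "parcs G" "{1..?D}" h] h(1) pair_finite_verts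
    unfolding labeling_def by auto
  have V: "pverts ?H = pverts G" by (simp add: graph_complement_def)
  have "distinguishing_chromatic_number G \<le> card (F ` pverts G)"
  proof (rule distinguishing_chromatic_number_le_card[OF assms F(1) h(2)])
    show "h u = h v" if "F u = F v" for u v
      using that F(2) by (metis comp_apply)
  qed
  moreover have "distinguishing_chromatic_number ?H \<le> card (F' ` pverts ?H)"
  proof (rule distinguishing_chromatic_number_le_card[OF pair_graph_complement[OF assms] _
          distinguishing_graph_complement[OF assms h(2)]])
    show "proper_on (pverts ?H) (parcs ?H) F'"
      using F'(1) by (auto simp: proper_on_def graph_complement_def)
    show "h u = h v" if "F' u = F' v" for u v
      using that F'(2) by (metis comp_apply)
  qed
  ultimately show ?thesis using le V by simp
qed

theorem corollary2p3:
  fixes G :: "'a pair_pre_digraph" and n :: nat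
  assumes "pair_graph G"
    and "n = card (pverts G)"
  shows "real (distinguishing_chromatic_number G) *
           real (distinguishing_chromatic_number (graph_complement G))
         \<le> ((real n + real (distinguishing_number G)) / 2)\<^sup>2"
proof -
  let ?a = "real (distinguishing_chromatic_number G)"
    and ?b = "real (distinguishing_chromatic_number (graph_complement G))"
  have "?a + ?b \<le> real n + real (distinguishing_number G)"
    using distinguishing_chromatic_number_sum_le[OF assms(1)] assms(2) by linarith
  then have "((?a + ?b) / 2)\<^sup>2 \<le> ((real n + real (distinguishing_number G)) / 2)\<^sup>2"
    by (intro power_mono) auto
  moreover have "?a * ?b \<le> ((?a + ?b) / 2)\<^sup>2"
    using zero_le_power2[of "?a - ?b"] by (simp add: power2_eq_square field_simps)
  ultimately show ?thesis by linarith
qed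

end
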